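(* Consider the finite-horizon risk-averse optimal stopping problem with transition kernels $Q_t$, stopping costs $s_t$, continuation costs $c_t$ and coherent one-step risk measures $\rho_t$. Suppose that $\rho_t$ is distribution-invariant for every $t$, and that the state space is a product $\mathcal X=\mathcal X_1\times\mathcal X_2$, where $\mathcal X_1\subseteq\mathbb R^{n_1}$ is equipped with a partial order $\preceq_1$ and $\mathcal X_2\subseteq\mathbb R^{n_2}$, with $n_1+n_2=n$, $n_1,n_2\ge1$. Write $x=(x_1,x_2)$ with $x_i\in\mathcal X_i$, and $\tilde X_{t+1}(x)=(\tilde X_{t+1,1}(x),\tilde X_{t+1,2}(x))\sim Q_t(\cdot\mid x)$. Suppose that for all $t$: (1) $c_t(x_1,x_2)$ (for $t<T$) and $s_t(x_1,x_2)$ (for $t\le T$) are decreasing in $x_1$; (2) $\tilde X_{t+1,2}(x)$ depends only on $x_2$ ($t<T$); (3) for fixed $x_2$ and conditioning on $\tilde X_{t+1,2}(x)$, $\tilde X_{t+1,1}(x_1,x_2)$ is stochastically increasing in $x_1$, i.e. $x_1\preceq_1x_1'$ implies $\tilde X_{t+1,1}(x_1,x_2)\preceq_{sd}\tilde X_{t+1,1}(x_1',x_2)$ ($t<T$). Then for every $t$ the value function $v_t(x_1,x_2)$ is decreasing in $x_1$.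
   Context: Setting. The horizon is $\{0,\dots,T\}$. $\{X_t\}_{t=0}^T$ is a Markov process on a probability space $(\Omega,\mathcal F,P_0)$ with state space $\mathcal X\cup\{\mathcal T\}$, where $\mathcal X\subseteq\mathbb R^n$ and $\mathcal T$ is an absorbing, cost-free terminal state; $\{\mathcal F_t\}$ is the filtration generated by $\{X_t\}$ and $\mathcal Z_t$ is the space of $\mathcal F_t$-measurable random variables. At each $t<T$ in state $x\in\mathcal X$ one either stops ($S$), paying $s_t(x)$ and moving to $\mathcal T$, or continues ($C$), paying $c_t(x)$ and moving according to the Markov transition kernel $Q_t(\cdot\mid x)$ on $\mathcal X$; $s_T$ is the cost at time $T$. Here $s_t,c_t:\mathcal X\to\mathbb R$. For fixed $x\in\mathcal X$, $\tilde X_{t+1}(x)$ denotes a random variable with law $Q_t(\cdot\mid x)$, representing the transition from state $x$ at time $t$, and $\rho_t(v(\tilde X_{t+1}(x)))$ is the one-step risk of $v$ of the next state, given state $x$ at time $t$. Risk measures. For $t=0,\dots,T-1$, $\rho_t:\mathcal Z_{t+1}\to\mathcal Z_t$ is a coherent one-step (conditional) risk measure: (convexity) $\rho_t(\lambda Z+(1-\lambda)W)\le\lambda\rho_t(Z)+(1-\lambda)\rho_t(W)$ for $\lambda\in[0,1]$, $Z,W\in\mathcal Z_{t+1}$; (monotonicity) $Z\le W$ a.s. implies $\rho_t(Z)\le\rho_t(W)$ for $Z,W\in\mathcal Z_{t+1}$; (translational invariance) $\rho_t(Z+W)=Z+\rho_t(W)$ for $Z\in\mathcal Z_t$, $W\in\mathcal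 Z_{t+1}$; (positive homogeneity) $\rho_t(\lambda W)=\lambda\rho_t(W)$ for $\lambda\ge0$, $W\in\mathcal Z_{t+1}$. It is distribution-invariant if $\rho_t(Z)=\rho_t(W)$ whenever $Z,W\in\mathcal Z_{t+1}$ are equal in distribution. Value functions. $v_T(x)=s_T(x)$ and, for $t<T$, $v_t(x)=\min\{s_t(x),\,c_t(x)+\rho_t(v_{t+1}(\tilde X_{t+1}(x)))\}$ (suitable regularity of kernels, risk mappings and costs is assumed so that this dynamic programming recursion is valid). Order notions. "Decreasing in $x_1$" means decreasing in $x_1$ with respect to $\preceq_1$ for each fixed $x_2$: $x_1\preceq_1x_1'$ implies $g(x_1,x_2)\ge g(x_1',x_2)$. For $\mathcal X_1$-valued random variables, $Y\preceq_{sd}X$ ($X$ first-order stochastically dominates $Y$) means $\mathbb E(g(X))\ge\mathbb E(g(Y))$ for every $g:\mathcal X_1\to\mathbb R$ that is increasing with respect to $\preceq_1$ (that is, $y\preceq_1 y'$ implies $g(y)\le g(y')$).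
   Formalization: Added: for each t<T there is an F_{t+1}-measurable uniform variable independent of F_t (the claim fails on spaces with unequal atoms), and X̃_{t+1}(x) is independent of F_t; distribution-invariance is with respect to conditional laws given F_t, and Z_t may be a smaller law-invariant space. *)

theory Defs
  imports "HOL-Probability.Probability"
begin

section \<open>Spaces of random variables and one-step conditional risk measures\<close>

text \<open>
  A risk measure that is finite on every random variable of an atomless space does not exist, so
  the random variables to which risk measures are applied range over a fixed space \<open>L\<close> of
  random variables: an arbitrary linear space that contains the constants and is stable under
  equality in distribution. Typical choices are \<open>L\<^sup>p\<close> for \<open>1 \<le> p \<le> \<infinity>\<close>, or all random
  variables.
\<close>

definition random_variable_space :: "'w measure \<Rightarrow> ('w \<Rightarrow> real) set \<Rightarrow> bool" where
  "random_variable_space M L \<longleftrightarrow>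
     L \<subseteq> borel_measurable M \<and>
     (\<forall>a. (\<lambda>_. a) \<in> L) \<and>
     (\<forall>Z\<in>L. \<forall>W\<in>L. (\<lambda>\<omega>. Z \<omega> + W \<omega>) \<in> L) \<and>
     (\<forall>Z\<in>L. \<forall>a. (\<lambda>\<omega>. a * Z \<omega>) \<in> L) \<and>
     (\<forall>Z\<in>L. \<forall>W\<in>borel_measurable M. distr M borel W = distr M borel Z \<longrightarrow> W \<in> L)"

text \<open>With \<open>G = \<F>\<^sub>t\<close> this is the space \<open>\<Z>\<^sub>t\<close>.\<close>

definition rv_space :: "('w \<Rightarrow> real) set \<Rightarrow> 'w measure \<Rightarrow> ('w \<Rightarrow> real) set" where
  "rv_space L G = L \<inter> borel_measurable G"

text \<open>Relations between values of a conditional risk measure are meant almost surely.\<close>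

definition coherent_one_step ::
  "'w measure \<Rightarrow> ('w \<Rightarrow> real) set \<Rightarrow> ('w \<Rightarrow> real) set \<Rightarrow> (('w \<Rightarrow> real) \<Rightarrow> 'w \<Rightarrow> real) \<Rightarrow> bool"
where
  "coherent_one_step M Z0 Z1 \<rho> \<longleftrightarrow>
     (\<forall>Z\<in>Z1. \<rho> Z \<in> Z0) \<and>
     (\<forall>Z\<in>Z1. \<forall>W\<in>Z1. \<forall>l\<in>{0..1}.
        AE \<omega> in M. \<rho> (\<lambda>\<omega>. l * Z \<omega> + (1 - l) * W \<omega>) \<omega> \<le> l * \<rho> Z \<omega> + (1 - l) * \<rho> W \<omega>) \<and>
     (\<forall>Z\<in>Z1. \<forall>W\<in>Z1. (AE \<omega> in M. Z \<omega> \<le> W \<omega>) \<longrightarrow> (AE \<omega> in M. \<rho> Z \<omega> \<le> \<rho> W \<omega>)) \<and>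
     (\<forall>Z\<in>Z0. \<forall>W\<in>Z1. AE \<omega> in M. \<rho> (\<lambda>\<omega>. Z \<omega> + W \<omega>) \<omega> = Z \<omega> + \<rho> W \<omega>) \<and>
     (\<forall>W\<in>Z1. \<forall>l\<ge>0. AE \<omega> in M. \<rho> (\<lambda>\<omega>. l * W \<omega>) \<omega> = l * \<rho> W \<omega>)"

text \<open>
  For a conditional risk measure, equality in distribution is equality of the conditional
  distributions given the information \<open>G\<close> at the time of evaluation. With unconditional laws the
  notion would be degenerate: translational invariance gives \<open>\<rho> Z = Z + \<rho> 0\<close> for
  \<open>G\<close>-measurable \<open>Z\<close>, so \<open>G\<close>-measurable variables with equal laws would have to coincide.
  Invariance with respect to unconditional laws implies the notion below.
\<close>

definition eq_cond_distr ::
  "'w measure \<Rightarrow> 'w measure \<Rightarrow> ('w \<Rightarrow> real) \<Rightarrow> ('w \<Rightarrow> real) \<Rightarrow> bool" where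
  "eq_cond_distr M G Z W \<longleftrightarrow>
     (\<forall>A\<in>sets borel. AE \<omega> in M.
        real_cond_exp M G (indicator (Z -` A \<inter> space M)) \<omega> =
        real_cond_exp M G (indicator (W -` A \<inter> space M)) \<omega>)"

definition distribution_invariant ::
  "'w measure \<Rightarrow> 'w measure \<Rightarrow> ('w \<Rightarrow> real) set \<Rightarrow> (('w \<Rightarrow> real) \<Rightarrow> 'w \<Rightarrow> real) \<Rightarrow> bool" where
  "distribution_invariant M G Z1 \<rho> \<longleftrightarrow>
     (\<forall>Z\<in>Z1. \<forall>W\<in>Z1. eq_cond_distr M G Z W \<longrightarrow> (AE \<omega> in M. \<rho> Z \<omega> = \<rho> W \<omega>))"


section \<open>Stochastic order\<close>

text \<open>
  \<open>sd_le le \<mu> \<nu>\<close> is the first-order dominance of the law \<open>\<mu>\<close> of \<open>Y\<close> by the law \<open>\<nu>\<close> of \<open>X\<close>;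
  the expectation of \<open>g(Y)\<close> is the integral of \<open>g\<close> against \<open>\<mu>\<close>. The test functions are those for
  which both expectations exist.
\<close>

definition sd_le :: "('a \<Rightarrow> 'a \<Rightarrow> bool) \<Rightarrow> 'a measure \<Rightarrow> 'a measure \<Rightarrow> bool" where
  "sd_le le \<mu> \<nu> \<longleftrightarrow>
     (\<forall>g :: 'a \<Rightarrow> real. monotone_on (space \<mu>) le (\<le>) g \<longrightarrow> integrable \<mu> g \<longrightarrow> integrable \<nu> g \<longrightarrow>
        integral\<^sup>L \<mu> g \<le> integral\<^sup>L \<nu> g)"

text \<open>
  \<open>\<kappa> y\<close> is a regular conditional law of the first component given that the second one equals
  \<open>y\<close>, under the joint law \<open>\<mu>\<close>.
\<close>

definition is_cond_law ::
  "'a measure \<Rightarrow> 'b measure \<Rightarrow> ('a \<times> 'b) measure \<Rightarrow> ('b \<Rightarrow> 'a measure) \<Rightarrow> bool" where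
  "is_cond_law S1 S2 \<mu> \<kappa> \<longleftrightarrow>
     \<kappa> \<in> S2 \<rightarrow>\<^sub>M prob_algebra S1 \<and>
     (\<forall>A\<in>sets S1. \<forall>B\<in>sets S2.
        emeasure \<mu> (A \<times> B) = (\<integral>\<^sup>+y\<in>B. emeasure (\<kappa> y) A \<partial>distr \<mu> S2 snd))"

text \<open>
  Dominance of the first component, conditionally on the second one, for joint laws with a common
  second marginal. On subsets of Euclidean spaces conditional laws are unique up to null sets, so
  the choice of \<open>\<kappa>\<close> and \<open>\<kappa>'\<close> is immaterial.
\<close>

definition cond_sd_le ::
  "('a \<Rightarrow> 'a \<Rightarrow> bool) \<Rightarrow> 'a measure \<Rightarrow> 'b measure \<Rightarrow> ('a \<times> 'b) measure \<Rightarrow> ('a \<times> 'b) measure \<Rightarrow> bool"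
where
  "cond_sd_le le S1 S2 \<mu> \<nu> \<longleftrightarrow>
     (\<exists>\<kappa> \<kappa>'. is_cond_law S1 S2 \<mu> \<kappa> \<and> is_cond_law S1 S2 \<nu> \<kappa>' \<and>
             (AE y in distr \<mu> S2 snd. sd_le le (\<kappa> y) (\<kappa>' y)))"

definition decreasing_in_first ::
  "'a set \<Rightarrow> 'b set \<Rightarrow> ('a \<Rightarrow> 'a \<Rightarrow> bool) \<Rightarrow> ('a \<times> 'b \<Rightarrow> real) \<Rightarrow> bool" where
  "decreasing_in_first X1 X2 le g \<longleftrightarrow> (\<forall>x2\<in>X2. monotone_on X1 le (\<ge>) (\<lambda>x1. g (x1, x2)))"


section \<open>The stopping problem\<close>

definition state_space ::
  "(real ^ 'm) set \<Rightarrow> (real ^ 'n) set \<Rightarrow> ((real ^ 'm) \<times> (real ^ 'n)) measure" where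
  "state_space X1 X2 = restrict_space borel X1 \<Otimes>\<^sub>M restrict_space borel X2"

text \<open>
  The process \<open>X\<close> is the one that runs as long as one continues; \<open>None\<close> is the absorbing terminal
  state, which carries no cost. \<open>Q t x\<close> is the law of the next state when
  continuing at time \<open>t\<close> in state \<open>x\<close>, and \<open>Xn (Suc t) x\<close> is the random variable representing this
  transition. Its state-\<open>x\<close> risk at time \<open>t\<close> is conditional only on being in \<open>x\<close>, so \<open>Xn (Suc t) x\<close>
  is independent of \<open>\<F>\<^sub>t\<close>.

  Risk measures act on \<open>\<F>\<^bsub>t+1\<^esub>\<close>-measurable variables, so \<open>\<F>\<close> has to carry the variables
  \<open>Xn (Suc t) x\<close>, which the states visited by \<open>X\<close> need not determine (for instance, for finite
  chains). Hence \<open>\<F>\<close> is any filtration with respect to which \<open>X\<close> is Markov; the filtration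
  generated by \<open>X\<close> is the smallest candidate.

  The assumption \<open>rich\<close> is the usual requirement that the space be atomless, relative to the
  information at time \<open>t\<close>. On spaces with atoms a distribution-invariant coherent risk measure need
  not respect first-order stochastic dominance: with two atoms of masses 1/3 and 2/3, evaluation at
  the first atom is coherent and distribution-invariant.
\<close>

locale risk_averse_stopping = prob_space M
  for M :: "'w measure"
    and T :: nat
    and F :: "nat \<Rightarrow> 'w measure"
    and X1 :: "(real ^ 'm) set"
    and X2 :: "(real ^ 'n) set"
    and X :: "nat \<Rightarrow> 'w \<Rightarrow> ((real ^ 'm) \<times> (real ^ 'n)) option"
    and Q :: "nat \<Rightarrow> (real ^ 'm) \<times> (real ^ 'n) \<Rightarrow> ((real ^ 'm) \<times> (real ^ 'n)) measure"
    and Xn :: "nat \<Rightarrow> (real ^ 'm) \<times> (real ^ 'n) \<Rightarrow> 'w \<Rightarrow> (real ^ 'm) \<times> (real ^ 'n)"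
    and L :: "('w \<Rightarrow> real) set"
    and \<rho> :: "nat \<Rightarrow> ('w \<Rightarrow> real) \<Rightarrow> 'w \<Rightarrow> real" +
  assumes filtration:
      "\<And>t. t \<le> T \<Longrightarrow> subalgebra M (F t)"
      "\<And>t. t < T \<Longrightarrow> subalgebra (F (Suc t)) (F t)"
    and kernel:
      "\<And>t. t < T \<Longrightarrow> Q t \<in> state_space X1 X2 \<rightarrow>\<^sub>M prob_algebra (state_space X1 X2)"
    and adapted:
      "\<And>t \<omega>. t \<le> T \<Longrightarrow> \<omega> \<in> space M \<Longrightarrow> X t \<omega> \<in> insert None (Some ` (X1 \<times> X2))"
      "\<And>t A. t \<le> T \<Longrightarrow> A \<in> sets (state_space X1 X2) \<Longrightarrow>
         X t -` Some ` A \<inter> space M \<in> sets (F t)"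
    and markov:
      "\<And>t A. t < T \<Longrightarrow> A \<in> sets (state_space X1 X2) \<Longrightarrow>
         AE \<omega> in M. real_cond_exp M (F t) (indicator (X (Suc t) -` Some ` A \<inter> space M)) \<omega> =
           (case X t \<omega> of None \<Rightarrow> 0 | Some x \<Rightarrow> measure (Q t x) A)"
    and transition_measurable:
      "\<And>t x. t < T \<Longrightarrow> x \<in> X1 \<times> X2 \<Longrightarrow> Xn (Suc t) x \<in> F (Suc t) \<rightarrow>\<^sub>M state_space X1 X2"
    and transition_law:
      "\<And>t x. t < T \<Longrightarrow> x \<in> X1 \<times> X2 \<Longrightarrow> distr M (state_space X1 X2) (Xn (Suc t) x) = Q t x"
    and transition_indep:
      "\<And>t x. t < T \<Longrightarrow> x \<in> X1 \<times> X2 \<Longrightarrow>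
         indep_set (sets (F t)) (sets (vimage_algebra (space M) (Xn (Suc t) x) (state_space X1 X2)))"
    and rich:
      "\<And>t. t < T \<Longrightarrow> \<exists>U \<in> borel_measurable (F (Suc t)).
         distr M borel U = uniform_measure lborel {0..1::real} \<and>
         indep_set (sets (F t)) (sets (vimage_algebra (space M) U borel))"
    and variables: "random_variable_space M L"
    and coherent:
      "\<And>t. t < T \<Longrightarrow> coherent_one_step M (rv_space L (F t)) (rv_space L (F (Suc t))) (\<rho> t)"

text \<open>
  The first two conjuncts are the dynamic programming recursion. Its right-hand side is a random
  variable, as \<open>\<rho> t\<close> takes values in \<open>\<Z>\<^sub>t\<close>, and the equation is meant almost surely for each
  fixed \<open>x\<close>. The last two conjuncts are the regularity under which it makes sense.
\<close>

definition value_functions ::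
  "'w measure \<Rightarrow> nat \<Rightarrow> (real ^ 'm) set \<Rightarrow> (real ^ 'n) set \<Rightarrow>
   (nat \<Rightarrow> (real ^ 'm) \<times> (real ^ 'n) \<Rightarrow> 'w \<Rightarrow> (real ^ 'm) \<times> (real ^ 'n)) \<Rightarrow>
   ('w \<Rightarrow> real) set \<Rightarrow> (nat \<Rightarrow> ('w \<Rightarrow> real) \<Rightarrow> 'w \<Rightarrow> real) \<Rightarrow>
   (nat \<Rightarrow> (real ^ 'm) \<times> (real ^ 'n) \<Rightarrow> real) \<Rightarrow> (nat \<Rightarrow> (real ^ 'm) \<times> (real ^ 'n) \<Rightarrow> real) \<Rightarrow>
   (nat \<Rightarrow> (real ^ 'm) \<times> (real ^ 'n) \<Rightarrow> real) \<Rightarrow> bool"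
where
  "value_functions M T X1 X2 Xn L \<rho> s c v \<longleftrightarrow>
     (\<forall>x\<in>X1 \<times> X2. v T x = s T x) \<and>
     (\<forall>t<T. \<forall>x\<in>X1 \<times> X2. AE \<omega> in M.
        v t x = min (s t x) (c t x + \<rho> t (\<lambda>\<omega>'. v (Suc t) (Xn (Suc t) x \<omega>')) \<omega>)) \<and>
     (\<forall>t\<le>T. v t \<in> borel_measurable (state_space X1 X2)) \<and>
     (\<forall>t<T. \<forall>x\<in>X1 \<times> X2. (\<lambda>\<omega>. v (Suc t) (Xn (Suc t) x \<omega>)) \<in> L)"

end

(* Backward induction on t. Sublevel sets of v_{t+1} are upward closed in the first component, so
   disintegrating along the common second marginal gives v_{t+1}(X(x1, x2)) first-order dominance
   over v_{t+1}(X(x1', x2)) as real random variables. The quantile transforms of a single uniform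
   variable independent of F_t realise both laws by almost surely ordered random variables;
   independence of F_t makes conditional laws equal to unconditional ones, so distribution
   invariance transfers the risks to these copies, where monotonicity applies. *)
theory Submission
  imports Defs
begin

section \<open>Disintegration along the second marginal and conditional dominance\<close>

text \<open>\<open>is_cond_law\<close> fixes the joint law on measurable rectangles only. These form
  an intersection-stable generator, so the joint law is the mixture of the slices over the second
  marginal; the section formula for general sets is needed because sublevel sets of a value function
  are not rectangles.\<close>

lemma is_cond_law_emeasure:
  assumes law: "is_cond_law S1 S2 \<mu> \<kappa>"
    and sets_\<mu>: "sets \<mu> = sets (S1 \<Otimes>\<^sub>M S2)"
    and prob_\<mu>: "prob_space \<mu>"
    and B: "B \<in> sets (S1 \<Otimes>\<^sub>M S2)"
  shows "emeasure \<mu> B = (\<integral>\<^sup>+y. emeasure (\<kappa> y) ((\<lambda>x. (x, y)) -` B) \<partial>distr \<mu> S2 snd)"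
proof -
  interpret \<mu>: prob_space \<mu> by (fact prob_\<mu>)
  let ?N = "distr \<mu> S2 snd"
  \<comment> \<open>\<open>K y\<close> places \<open>\<kappa> y\<close> on the slice with second
    coordinate \<open>y\<close>, so binding the second marginal with \<open>K\<close> rebuilds a
    measure on the product.\<close>
  define K where "K y = distr (\<kappa> y) (S1 \<Otimes>\<^sub>M S2) (\<lambda>x. (x, y))" for y
  have snd_meas: "snd \<in> \<mu> \<rightarrow>\<^sub>M S2"
    using measurable_snd[of S1 S2] measurable_cong_sets[OF sets_\<mu> refl, of S2] by simp
  interpret N: prob_space ?N by (rule \<mu>.prob_space_distr[OF snd_meas])
  have \<kappa>: "\<kappa> \<in> S2 \<rightarrow>\<^sub>M prob_algebra S1"
    using law by (simp add: is_cond_law_def)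
  have sets_\<kappa>: "sets (\<kappa> y) = sets S1" "space (\<kappa> y) = space S1" if "y \<in> space S2" for y
    using measurable_space[OF \<kappa> that] sets_eq_imp_space_eq by (auto simp: space_prob_algebra)
  have K: "K \<in> ?N \<rightarrow>\<^sub>M subprob_algebra (S1 \<Otimes>\<^sub>M S2)"
    unfolding K_def
  proof (rule measurable_distr2[where M = S1])
    show "\<kappa> \<in> ?N \<rightarrow>\<^sub>M subprob_algebra S1"
      using measurable_prob_algebraD[OF \<kappa>] by simp
    show "(\<lambda>(y, x). (x, y)) \<in> ?N \<Otimes>\<^sub>M S1 \<rightarrow>\<^sub>M S1 \<Otimes>\<^sub>M S2"
      by measurable
  qed
  have K_em: "emeasure (K y) C = emeasure (\<kappa> y) ((\<lambda>x. (x, y)) -` C)"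
    if y: "y \<in> space S2" and C: "C \<in> sets (S1 \<Otimes>\<^sub>M S2)" for y C
  proof -
    have m: "(\<lambda>x. (x, y)) \<in> \<kappa> y \<rightarrow>\<^sub>M S1 \<Otimes>\<^sub>M S2"
      using measurable_Pair2'[OF y, of S1] sets_\<kappa>(1)[OF y] by (simp cong: measurable_cong_sets)
    have "(\<lambda>x. (x, y)) -` C \<subseteq> space (\<kappa> y)"
      using sets.sets_into_space[OF C] sets_\<kappa>(2)[OF y] by (auto simp: space_pair_measure)
    then show ?thesis
      unfolding K_def by (simp add: emeasure_distr[OF m C] Int_absorb2)
  qed
  have bind: "emeasure (?N \<bind> K) C
      = (\<integral>\<^sup>+y. emeasure (\<kappa> y) ((\<lambda>x. (x, y)) -` C) \<partial>?N)"
    if C: "C \<in> sets (S1 \<Otimes>\<^sub>M S2)" for C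
    unfolding emeasure_bind[OF N.not_empty K C]
    by (rule nn_integral_cong) (simp add: K_em C)
  let ?E = "{a \<times> b | a b. a \<in> sets S1 \<and> b \<in> sets S2}"
  let ?\<Omega> = "space S1 \<times> space S2"
  have "\<mu> = ?N \<bind> K"
  \<comment> \<open>As \<open>\<mu>\<close> is finite, the constant sequence of whole spaces serves
    as the exhaustion.\<close>
  proof (rule measure_eqI_generator_eq[where E = ?E and \<Omega> = ?\<Omega> and A = "\<lambda>_::nat. ?\<Omega>"])
    show "Int_stable ?E" by (rule Int_stable_pair_measure_generator)
    show "?E \<subseteq> Pow ?\<Omega>" by (auto dest: sets.sets_into_space)
    show "sets \<mu> = sigma_sets ?\<Omega> ?E"
      using sets_\<mu> by (simp add: sets_pair_measure)
    show "sets (?N \<bind> K) = sigma_sets ?\<Omega> ?E"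
      using sets_bind[OF sets_kernel[OF K] N.not_empty] by (simp add: sets_pair_measure)
    show "emeasure \<mu> C = emeasure (?N \<bind> K) C" if "C \<in> ?E" for C
    proof -
      from that obtain a b where C: "C = a \<times> b" "a \<in> sets S1" "b \<in> sets S2" by blast
      have "emeasure \<mu> C = (\<integral>\<^sup>+y\<in>b. emeasure (\<kappa> y) a \<partial>?N)"
        using law C by (simp add: is_cond_law_def)
      \<comment> \<open>The section of \<open>a \<times> b\<close> at \<open>y\<close> is
        \<open>a\<close> for \<open>y\<close> in \<open>b\<close> and empty otherwise.\<close>
      also have "\<dots> = (\<integral>\<^sup>+y. emeasure (\<kappa> y) ((\<lambda>x. (x, y)) -` C) \<partial>?N)"
        by (intro nn_integral_cong) (auto simp: C(1) indicator_def)
      finally show ?thesis using bind C by simp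
    qed
  qed auto
  then show ?thesis using bind[OF B] by simp
qed

text \<open>By \<open>up\<close>, each section of \<open>B\<close> has an increasing indicator, a
  legitimate test function for \<open>sd_le\<close>. The sectionwise inequalities can then be
  integrated, since both joint laws disintegrate over the same second marginal.\<close>

lemma cond_sd_le_emeasure_mono:
  assumes dom: "cond_sd_le le S1 S2 \<mu> \<nu>"
    and sets_eq: "sets \<mu> = sets (S1 \<Otimes>\<^sub>M S2)" "sets \<nu> = sets (S1 \<Otimes>\<^sub>M S2)"
    and prob: "prob_space \<mu>" "prob_space \<nu>"
    and marginal: "distr \<mu> S2 snd = distr \<nu> S2 snd"
    and B: "B \<in> sets (S1 \<Otimes>\<^sub>M S2)"
    and up: "\<And>x x' y. x \<in> space S1 \<Longrightarrow> x' \<in> space S1 \<Longrightarrow> le x x' \<Longrightarrow> (x, y) \<in> B \<Longrightarrow> (x', y) \<in> B"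
  shows "emeasure \<mu> B \<le> emeasure \<nu> B"
proof -
  from dom obtain \<kappa> \<kappa>' where law: "is_cond_law S1 S2 \<mu> \<kappa>" "is_cond_law S1 S2 \<nu> \<kappa>'"
    and sd: "AE y in distr \<mu> S2 snd. sd_le le (\<kappa> y) (\<kappa>' y)"
    unfolding cond_sd_le_def by blast
  have "(\<integral>\<^sup>+y. emeasure (\<kappa> y) ((\<lambda>x. (x, y)) -` B) \<partial>distr \<mu> S2 snd)
      \<le> (\<integral>\<^sup>+y. emeasure (\<kappa>' y) ((\<lambda>x. (x, y)) -` B) \<partial>distr \<mu> S2 snd)"
  proof (rule nn_integral_mono_AE, use sd AE_space in eventually_elim)
    case (elim y)
    let ?B = "(\<lambda>x. (x, y)) -` B"
    have y: "y \<in> space S2" using elim by simp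
    have k: "\<kappa> y \<in> space (prob_algebra S1)" "\<kappa>' y \<in> space (prob_algebra S1)"
      using law measurable_space[OF _ y] unfolding is_cond_law_def by blast+
    then have sets_k: "sets (\<kappa> y) = sets S1" "sets (\<kappa>' y) = sets S1" "space (\<kappa> y) = space S1"
      using sets_eq_imp_space_eq by (auto simp: space_prob_algebra)
    interpret k: prob_space "\<kappa> y" using k by (simp add: space_prob_algebra)
    interpret k': prob_space "\<kappa>' y" using k by (simp add: space_prob_algebra)
    have "?B \<in> sets S1" using sets_Pair2[OF B] .
    then have B_sets: "?B \<in> sets (\<kappa> y)" "?B \<in> sets (\<kappa>' y)" using sets_k by auto
    \<comment> \<open>The test function is the indicator of the section; being bounded, it is
      integrable under both conditional laws, so its expectations are the two measures to
      compare.\<close>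
    have "monotone_on (space (\<kappa> y)) le (\<le>) (indicat_real ?B)"
      unfolding sets_k by (rule monotone_onI) (auto simp: indicator_def intro: up)
    moreover have "integrable (\<kappa> y) (indicat_real ?B)" "integrable (\<kappa>' y) (indicat_real ?B)"
      using B_sets by (simp_all add: less_top[symmetric])
    ultimately have "integral\<^sup>L (\<kappa> y) (indicat_real ?B) \<le> integral\<^sup>L (\<kappa>' y) (indicat_real ?B)"
      using elim(1) unfolding sd_le_def by blast
    then show ?case
      using B_sets sets.sets_into_space[OF B_sets(1)] sets.sets_into_space[OF B_sets(2)]
      by (simp add: k.emeasure_eq_measure k'.emeasure_eq_measure Int_absorb2)
  qed
  then show ?thesis
    unfolding is_cond_law_emeasure[OF law(1) sets_eq(1) prob(1) B]
      is_cond_law_emeasure[OF law(2) sets_eq(2) prob(2) B] marginal .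
qed

section \<open>Quantile transforms and monotone coupling on the real line\<close>

text \<open>The function is the generalized inverse \<open>I\<close> of the cdf, made total. The
  third property is the Galois connection between quantile and cdf, which turns an order between
  cdfs into the reverse order between quantiles.\<close>

lemma (in real_distribution) quantile_function:
  obtains q :: "real \<Rightarrow> real"
  where "q \<in> borel_measurable borel"
    and "distr (uniform_measure lborel {0..1}) borel q = M"
    and "\<And>u x. u \<in> {0<..<1} \<Longrightarrow> u \<le> cdf M x \<longleftrightarrow> q u \<le> x"
proof -
  interpret cdf_distribution M by unfold_locales
  \<comment> \<open>The value 0 outside the open unit interval is arbitrary: the uniform law gives
    no mass there.\<close>
  define q where "q u = (if u \<in> {0<..<1} then I u else 0)" for u :: real
  have q_meas: "q \<in> borel_measurable borel"
    unfolding q_def using measurable_CI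
    by (subst measurable_If_restrict_space_iff)
      (auto simp: greaterThanLessThan_def greaterThan_def lessThan_def Int_def)
  have "distr (uniform_measure lborel {0..1}) borel q
      = distr (restrict_space lborel {0<..<1::real}) borel I"
  proof (rule measure_eqI)
    fix A assume "A \<in> sets (distr (uniform_measure lborel {0..1}) borel q)"
    then have A: "A \<in> sets borel" by simp
    have qA: "q -` A \<in> sets borel" using measurable_sets[OF q_meas A] by simp
    have I: "I \<in> borel_measurable (restrict_space lborel {0<..<1})"
      using measurable_CI by (simp cong: measurable_cong_sets add: sets_restrict_space)
    have "emeasure (distr (uniform_measure lborel {0..1}) borel q) A
        = emeasure lborel ({0..1} \<inter> q -` A)"
      using q_meas A qA by (simp add: emeasure_distr divide_ennreal_def)
    \<comment> \<open>The uniform law lives on the closed interval and \<open>I\<close> on the open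
      one; the two endpoints are null.\<close>
    also have "\<dots> = emeasure lborel ({0<..<1} \<inter> q -` A)"
      by (rule emeasure_eq_AE)
        (use AE_lborel_singleton[of 0] AE_lborel_singleton[of 1] qA in \<open>auto elim!: eventually_elim2\<close>)
    also have "{0<..<1} \<inter> q -` A = I -` A \<inter> {0<..<1}"
      by (auto simp: q_def)
    also have "emeasure lborel \<dots> = emeasure (distr (restrict_space lborel {0<..<1}) borel I) A"
      using I A by (simp add: emeasure_distr emeasure_restrict_space space_restrict_space)
    finally show "emeasure (distr (uniform_measure lborel {0..1}) borel q) A
      = emeasure (distr (restrict_space lborel {0<..<1}) borel I) A" .
  qed simp
  then have "distr (uniform_measure lborel {0..1}) borel q = M"
    using distr_I_eq_M by simp
  moreover have "u \<le> cdf M x \<longleftrightarrow> q u \<le> x" if "u \<in> {0<..<1}" for u x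
  proof -
    have "q u = I u" using that by (simp add: q_def)
    then show ?thesis using pseudoinverse'[THEN bspec, OF that, THEN spec, of x] by (simp only:)
  qed
  ultimately show thesis using that q_meas by blast
qed

text \<open>Feeding the same uniform variable into both quantile functions keeps both laws, and the
  pointwise larger cdf, that of \<open>W\<close>, has the smaller quantiles.\<close>

lemma monotone_coupling:
  fixes Z W :: "'w \<Rightarrow> real"
  assumes M: "prob_space M"
    and ZW: "Z \<in> borel_measurable M" "W \<in> borel_measurable M"
    and U: "U \<in> borel_measurable M" "distr M borel U = uniform_measure lborel {0..1::real}"
    and dom: "\<And>a. cdf (distr M borel Z) a \<le> cdf (distr M borel W) a"
  obtains q r :: "real \<Rightarrow> real"
  where "q \<in> borel_measurable borel" "r \<in> borel_measurable borel"
    and "distr M borel (\<lambda>\<omega>. q (U \<omega>)) = distr M borel Z"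
    and "distr M borel (\<lambda>\<omega>. r (U \<omega>)) = distr M borel W"
    and "AE \<omega> in M. r (U \<omega>) \<le> q (U \<omega>)"
proof -
  interpret prob_space M by (fact M)
  interpret Z: real_distribution "distr M borel Z" using ZW by simp
  interpret W: real_distribution "distr M borel W" using ZW by simp
  obtain q where q: "q \<in> borel_measurable borel"
      "distr (uniform_measure lborel {0..1}) borel q = distr M borel Z"
      "\<And>u x. u \<in> {0<..<1} \<Longrightarrow> u \<le> cdf (distr M borel Z) x \<longleftrightarrow> q u \<le> x"
    using Z.quantile_function by metis
  obtain r where r: "r \<in> borel_measurable borel"
      "distr (uniform_measure lborel {0..1}) borel r = distr M borel W"
      "\<And>u x. u \<in> {0<..<1} \<Longrightarrow> u \<le> cdf (distr M borel W) x \<longleftrightarrow> r u \<le> x"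
    using W.quantile_function by metis
  have "distr M borel (\<lambda>\<omega>. q (U \<omega>)) = distr M borel Z"
    using distr_distr[OF q(1) U(1)] U(2) q(2) by (simp add: comp_def)
  moreover have "distr M borel (\<lambda>\<omega>. r (U \<omega>)) = distr M borel W"
    using distr_distr[OF r(1) U(1)] U(2) r(2) by (simp add: comp_def)
  moreover have "AE \<omega> in M. r (U \<omega>) \<le> q (U \<omega>)"
  proof -
    \<comment> \<open>Evaluate both cdfs at the point \<open>q u\<close>: the Galois connection for
      \<open>q\<close> gives that \<open>u\<close> is at most the cdf of \<open>Z\<close> there,
      hence at most that of \<open>W\<close>, and the one for \<open>r\<close> concludes.\<close>
    have "r u \<le> q u" if u: "u \<in> {0<..<1}" for u
      using q(3)[OF u, of "q u"] r(3)[OF u, of "q u"] dom[of "q u"] by linarith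
    then have "AE u in uniform_measure lborel {0..1}. r u \<le> q u"
      using AE_lborel_singleton[of "0::real"] AE_lborel_singleton[of "1::real"]
      by (intro AE_uniform_measureI) (auto elim!: eventually_elim2)
    then have "AE u in distr M borel U. r u \<le> q u" unfolding U(2) .
    moreover have "{u \<in> space borel. r u \<le> q u} \<in> sets borel"
      using borel_measurable_le[OF r(1) q(1)] .
    ultimately show ?thesis using AE_distr_iff[OF U(1)] by simp
  qed
  ultimately show thesis using that q(1) r(1) by blast
qed

section \<open>Independence and conditional distributions\<close>

text \<open>The constant \<open>prob B\<close> passes the characterizing test of conditional
  expectation: over each \<open>A\<close> in \<open>G\<close>, both integrals equal
  \<open>prob A * prob B\<close> by independence.\<close>

lemma (in prob_space) real_cond_exp_indicator_indep:
  assumes sub: "subalgebra M G"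
    and indep: "indep_set (sets G) \<A>" and B: "B \<in> \<A>"
  shows "AE \<omega> in M. real_cond_exp M G (indicator B) \<omega> = prob B"
proof -
  interpret finite_measure_subalgebra M G by unfold_locales (fact sub)
  have B_ev: "B \<in> events" using indep_setD_ev2[OF indep] B by blast
  show ?thesis
  proof (rule real_cond_exp_charact)
    fix A assume A: "A \<in> sets G"
    then have A_ev: "A \<in> events" using sub by (auto simp: subalgebra_def)
    have "(\<integral>x\<in>A. indicator B x \<partial>M) = prob (A \<inter> B)"
      using A_ev B_ev sets.sets_into_space[OF A_ev]
      by (simp add: set_lebesgue_integral_def indicator_inter_arith[symmetric] Int_absorb2 le_infI1)
    also have "\<dots> = (\<integral>x\<in>A. prob B \<partial>M)"
      using A_ev indep_setD[OF indep A B] by (simp add: set_lebesgue_integral_def)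
    finally show "(\<integral>x\<in>A. indicator B x \<partial>M) = (\<integral>x\<in>A. prob B \<partial>M)" .
  qed (use B_ev in \<open>simp_all add: less_top[symmetric]\<close>)
qed

text \<open>Lets independence from \<open>H\<close> be used for functions of \<open>H\<close>, whose
  events are already events of \<open>H\<close>.\<close>

lemma vimage_algebra_compose:
  assumes "H \<in> M \<rightarrow>\<^sub>M R" and "g \<in> R \<rightarrow>\<^sub>M N" and "A \<in> sets N"
  shows "(\<lambda>\<omega>. g (H \<omega>)) -` A \<inter> space M \<in> sets (vimage_algebra (space M) H R)"
proof -
  have "g -` A \<inter> space R \<in> sets R" using assms by (simp add: measurable_sets)
  moreover have "(\<lambda>\<omega>. g (H \<omega>)) -` A \<inter> space M = H -` (g -` A \<inter> space R) \<inter> space M"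
    using measurable_space[OF assms(1)] by auto
  ultimately show ?thesis by (simp only: in_vimage_algebra)
qed

text \<open>Independence collapses both conditional probabilities to unconditional ones, so equal
  laws suffice for the hypothesis of \<open>distribution_invariant\<close>. The spaces
  \<open>S\<close> and \<open>S'\<close> differ because one variable will be a real uniform variable
  and the other a random state.\<close>

lemma (in prob_space) eq_cond_distr_indep:
  assumes sub: "subalgebra M G"
    and indep_Y: "indep_set (sets G) (sets (vimage_algebra (space M) Y S))"
    and indep_Y': "indep_set (sets G) (sets (vimage_algebra (space M) Y' S'))"
    and Y: "Y \<in> M \<rightarrow>\<^sub>M S" and Y': "Y' \<in> M \<rightarrow>\<^sub>M S'"
    and f: "f \<in> borel_measurable S" and f': "f' \<in> borel_measurable S'"
    and law: "distr M borel (\<lambda>\<omega>. f (Y \<omega>)) = distr M borel (\<lambda>\<omega>. f' (Y' \<omega>))"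
  shows "eq_cond_distr M G (\<lambda>\<omega>. f (Y \<omega>)) (\<lambda>\<omega>. f' (Y' \<omega>))"
  unfolding eq_cond_distr_def
proof
  fix A :: "real set" assume A: "A \<in> sets borel"
  have "measure (distr M borel (\<lambda>\<omega>. f (Y \<omega>))) A = measure (distr M borel (\<lambda>\<omega>. f' (Y' \<omega>))) A"
    using law by simp
  then have eq: "prob ((\<lambda>\<omega>. f (Y \<omega>)) -` A \<inter> space M) = prob ((\<lambda>\<omega>. f' (Y' \<omega>)) -` A \<inter> space M)"
    using measurable_compose[OF Y f] measurable_compose[OF Y' f'] A by (simp add: measure_distr)
  show "AE \<omega> in M.
      real_cond_exp M G (indicator ((\<lambda>\<omega>. f (Y \<omega>)) -` A \<inter> space M)) \<omega> =
      real_cond_exp M G (indicator ((\<lambda>\<omega>. f' (Y' \<omega>)) -` A \<inter> space M)) \<omega>"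
    using real_cond_exp_indicator_indep[OF sub indep_Y vimage_algebra_compose[OF Y f A]]
      real_cond_exp_indicator_indep[OF sub indep_Y' vimage_algebra_compose[OF Y' f' A]]
    by eventually_elim (simp add: eq)
qed

section \<open>Monotonicity of the one-step risk under first-order dominance\<close>

context risk_averse_stopping
begin

text \<open>More mass in the sublevel sets under \<open>Q t x'\<close> means smaller values of
  \<open>g\<close> after the transition from \<open>x'\<close>. These values need not be ordered
  pointwise, so monotonicity of \<open>\<rho> t\<close> is applied to coupled copies with the same
  risks.\<close>

lemma risk_mono:
  assumes t: "t < T"
    and inv: "distribution_invariant M (F t) (rv_space L (F (Suc t))) (\<rho> t)"
    and x: "x \<in> X1 \<times> X2" and x': "x' \<in> X1 \<times> X2"
    and g: "g \<in> borel_measurable (state_space X1 X2)"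
    and gL: "(\<lambda>\<omega>. g (Xn (Suc t) x \<omega>)) \<in> L" "(\<lambda>\<omega>. g (Xn (Suc t) x' \<omega>)) \<in> L"
    and dom: "\<And>a. emeasure (Q t x) {z \<in> space (state_space X1 X2). g z \<le> a}
      \<le> emeasure (Q t x') {z \<in> space (state_space X1 X2). g z \<le> a}"
  shows "AE \<omega> in M. \<rho> t (\<lambda>\<omega>. g (Xn (Suc t) x' \<omega>)) \<omega> \<le> \<rho> t (\<lambda>\<omega>. g (Xn (Suc t) x \<omega>)) \<omega>"
proof -
  let ?S = "state_space X1 X2" and ?F = "F (Suc t)"
  have sub: "subalgebra M (F t)" and sub': "subalgebra M ?F"
    using t filtration(1) by simp_all
  \<comment> \<open>Measurability at time \<open>Suc t\<close> makes functions of \<open>U\<close>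
    admissible arguments of \<open>\<rho> t\<close>; independence of \<open>F t\<close> makes their
    conditional laws deterministic.\<close>
  obtain U where U: "U \<in> borel_measurable ?F" "distr M borel U = uniform_measure lborel {0..1::real}"
      "indep_set (sets (F t)) (sets (vimage_algebra (space M) U borel))"
    using rich[OF t] by blast
  have UM: "U \<in> borel_measurable M" using measurable_from_subalg[OF sub' U(1)] .
  have Xn: "Xn (Suc t) z \<in> M \<rightarrow>\<^sub>M ?S" if "z \<in> X1 \<times> X2" for z
    using measurable_from_subalg[OF sub' transition_measurable[OF t that]] .
  have cdf: "cdf (distr M borel (\<lambda>\<omega>. g (Xn (Suc t) z \<omega>))) a
      = measure (Q t z) {w \<in> space ?S. g w \<le> a}" if z: "z \<in> X1 \<times> X2" for z a
  proof -
    have "distr M borel (\<lambda>\<omega>. g (Xn (Suc t) z \<omega>)) = distr (Q t z) borel g"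
      unfolding transition_law[OF t z, symmetric] using distr_distr[OF g Xn[OF z]]
      by (simp add: comp_def)
    moreover have "g \<in> borel_measurable (Q t z)" "space (Q t z) = space ?S"
      using g unfolding transition_law[OF t z, symmetric] by simp_all
    moreover have "g -` {..a} \<inter> space ?S = {w \<in> space ?S. g w \<le> a}" by auto
    ultimately show ?thesis by (simp add: cdf_def measure_distr)
  qed
  \<comment> \<open>\<open>enn2real\<close> sends infinity to 0, so passing from \<open>dom\<close>
    to real-valued cdfs requires the larger side to be finite.\<close>
  have fin: "emeasure (Q t x') A \<noteq> \<infinity>" for A
  proof -
    interpret Q: prob_space "Q t x'"
      unfolding transition_law[OF t x', symmetric] by (rule prob_space_distr[OF Xn[OF x']])
    show ?thesis by simp
  qed
  have le: "cdf (distr M borel (\<lambda>\<omega>. g (Xn (Suc t) x \<omega>))) a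
      \<le> cdf (distr M borel (\<lambda>\<omega>. g (Xn (Suc t) x' \<omega>))) a" for a
    unfolding cdf[OF x] cdf[OF x'] measure_def
    using dom[of a] fin by (intro enn2real_mono) (auto simp: less_top)
  obtain q r :: "real \<Rightarrow> real" where qr: "q \<in> borel_measurable borel" "r \<in> borel_measurable borel"
    and law: "distr M borel (\<lambda>\<omega>. q (U \<omega>)) = distr M borel (\<lambda>\<omega>. g (Xn (Suc t) x \<omega>))"
      "distr M borel (\<lambda>\<omega>. r (U \<omega>)) = distr M borel (\<lambda>\<omega>. g (Xn (Suc t) x' \<omega>))"
    and le_AE: "AE \<omega> in M. r (U \<omega>) \<le> q (U \<omega>)"
    by (rule monotone_coupling[OF prob_space_axioms measurable_compose[OF Xn[OF x] g]
        measurable_compose[OF Xn[OF x'] g] UM U(2) le])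
  \<comment> \<open>The copies stay in \<open>L\<close> because \<open>L\<close> is stable under
    equality in distribution; invariance then equates the risks.\<close>
  have same_risk: "(\<lambda>\<omega>. p (U \<omega>)) \<in> rv_space L ?F"
    "AE \<omega> in M. \<rho> t (\<lambda>\<omega>. p (U \<omega>)) \<omega> = \<rho> t (\<lambda>\<omega>. g (Xn (Suc t) z \<omega>)) \<omega>"
    if z: "z \<in> X1 \<times> X2" and p: "p \<in> borel_measurable borel"
      and zL: "(\<lambda>\<omega>. g (Xn (Suc t) z \<omega>)) \<in> L"
      and l: "distr M borel (\<lambda>\<omega>. p (U \<omega>)) = distr M borel (\<lambda>\<omega>. g (Xn (Suc t) z \<omega>))" for z p
  proof -
    have "\<forall>Z\<in>L. \<forall>W\<in>borel_measurable M. distr M borel W = distr M borel Z \<longrightarrow> W \<in> L"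
      using variables unfolding random_variable_space_def by (elim conjE)
    then have "(\<lambda>\<omega>. p (U \<omega>)) \<in> L"
      using zL l measurable_compose[OF UM p] by metis
    then show pL: "(\<lambda>\<omega>. p (U \<omega>)) \<in> rv_space L ?F"
      using measurable_compose[OF U(1) p] by (simp add: rv_space_def)
    have gz: "(\<lambda>\<omega>. g (Xn (Suc t) z \<omega>)) \<in> rv_space L ?F"
      using zL measurable_compose[OF transition_measurable[OF t z] g] by (simp add: rv_space_def)
    have "eq_cond_distr M (F t) (\<lambda>\<omega>. p (U \<omega>)) (\<lambda>\<omega>. g (Xn (Suc t) z \<omega>))"
      using eq_cond_distr_indep[OF sub U(3) transition_indep[OF t z] UM Xn[OF z] p g l] .
    then show "AE \<omega> in M. \<rho> t (\<lambda>\<omega>. p (U \<omega>)) \<omega> = \<rho> t (\<lambda>\<omega>. g (Xn (Suc t) z \<omega>)) \<omega>"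
      by (rule inv[unfolded distribution_invariant_def, rule_format, OF pL gz])
  qed
  have "\<forall>Z\<in>rv_space L ?F. \<forall>W\<in>rv_space L ?F.
      (AE \<omega> in M. Z \<omega> \<le> W \<omega>) \<longrightarrow> (AE \<omega> in M. \<rho> t Z \<omega> \<le> \<rho> t W \<omega>)"
    using coherent[OF t] unfolding coherent_one_step_def by (elim conjE)
  from this[rule_format, OF same_risk(1)[OF x' qr(2) gL(2) law(2)]
      same_risk(1)[OF x qr(1) gL(1) law(1)] le_AE]
  have "AE \<omega> in M. \<rho> t (\<lambda>\<omega>. r (U \<omega>)) \<omega> \<le> \<rho> t (\<lambda>\<omega>. q (U \<omega>)) \<omega>" .
  then show ?thesis
    using same_risk(2)[OF x qr(1) gL(1) law(1)] same_risk(2)[OF x' qr(2) gL(2) law(2)]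
    by eventually_elim simp
qed

end

section \<open>Backward induction for the value functions\<close>

theorem theorem2:
  fixes M :: "'w measure"
    and T :: nat
    and F :: "nat \<Rightarrow> 'w measure"
    and X1 :: "(real ^ 'n1) set"
    and X2 :: "(real ^ 'n2) set"
    and le1 :: "real ^ 'n1 \<Rightarrow> real ^ 'n1 \<Rightarrow> bool"
    and X :: "nat \<Rightarrow> 'w \<Rightarrow> ((real ^ 'n1) \<times> (real ^ 'n2)) option"
    and Q :: "nat \<Rightarrow> (real ^ 'n1) \<times> (real ^ 'n2) \<Rightarrow> ((real ^ 'n1) \<times> (real ^ 'n2)) measure"
    and Xn :: "nat \<Rightarrow> (real ^ 'n1) \<times> (real ^ 'n2) \<Rightarrow> 'w \<Rightarrow> (real ^ 'n1) \<times> (real ^ 'n2)"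
    and L :: "('w \<Rightarrow> real) set"
    and \<rho> :: "nat \<Rightarrow> ('w \<Rightarrow> real) \<Rightarrow> 'w \<Rightarrow> real"
    and s c v :: "nat \<Rightarrow> (real ^ 'n1) \<times> (real ^ 'n2) \<Rightarrow> real"
  assumes problem: "risk_averse_stopping M T F X1 X2 X Q Xn L \<rho>"
    and value_functions: "value_functions M T X1 X2 Xn L \<rho> s c v"
    and invariant:
      "\<And>t. t < T \<Longrightarrow> distribution_invariant M (F t) (rv_space L (F (Suc t))) (\<rho> t)"
    and partial_order: "reflp_on X1 le1" "transp_on X1 le1" "antisymp_on X1 le1"
    and c_decreasing: "\<And>t. t < T \<Longrightarrow> decreasing_in_first X1 X2 le1 (c t)"
    and s_decreasing: "\<And>t. t \<le> T \<Longrightarrow> decreasing_in_first X1 X2 le1 (s t)"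
    and second_component: "\<And>t x1 x1' x2. t < T \<Longrightarrow> x1 \<in> X1 \<Longrightarrow> x1' \<in> X1 \<Longrightarrow> x2 \<in> X2 \<Longrightarrow>
        distr (Q t (x1, x2)) (restrict_space borel X2) snd =
        distr (Q t (x1', x2)) (restrict_space borel X2) snd"
    and first_component: "\<And>t x1 x1' x2. t < T \<Longrightarrow> x1 \<in> X1 \<Longrightarrow> x1' \<in> X1 \<Longrightarrow> x2 \<in> X2 \<Longrightarrow>
        le1 x1 x1' \<Longrightarrow>
        cond_sd_le le1 (restrict_space borel X1) (restrict_space borel X2)
          (Q t (x1, x2)) (Q t (x1', x2))"
  shows "\<forall>t\<le>T. decreasing_in_first X1 X2 le1 (v t)"
proof (intro allI impI)
  interpret risk_averse_stopping M T F X1 X2 X Q Xn L \<rho> by (fact problem)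
  let ?S1 = "restrict_space borel X1" and ?S2 = "restrict_space borel X2"
  have S: "state_space X1 X2 = ?S1 \<Otimes>\<^sub>M ?S2" by (simp add: state_space_def)
  fix t assume "t \<le> T"
  then show "decreasing_in_first X1 X2 le1 (v t)"
  \<comment> \<open>The induction descends from the horizon: the base case is \<open>T\<close>, and
    the step passes from \<open>Suc t\<close> to \<open>t\<close>.\<close>
  proof (induction rule: inc_induct)
    case base
    have "v T x = s T x" if "x \<in> X1 \<times> X2" for x
      using value_functions that unfolding value_functions_def by blast
    then show ?case
      using s_decreasing[of T] by (auto simp: decreasing_in_first_def monotone_on_def)
  next
    case (step t)
    have t: "t < T" by (fact step.hyps)
    have g: "v (Suc t) \<in> borel_measurable (state_space X1 X2)"
      using value_functions t unfolding value_functions_def by (meson Suc_leI)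
    have "v t (x1', x2) \<le> v t (x1, x2)"
      if x: "x1 \<in> X1" "x1' \<in> X1" "x2 \<in> X2" and le: "le1 x1 x1'" for x1 x1' x2
    proof -
      have mem: "(x1, x2) \<in> X1 \<times> X2" "(x1', x2) \<in> X1 \<times> X2" using x by auto
      then have mem': "(x1, x2) \<in> space (state_space X1 X2)" "(x1', x2) \<in> space (state_space X1 X2)"
        by (auto simp: S space_pair_measure space_restrict_space)
      have dp: "AE \<omega> in M.
          v t z = min (s t z) (c t z + \<rho> t (\<lambda>\<omega>'. v (Suc t) (Xn (Suc t) z \<omega>')) \<omega>)"
        and L: "(\<lambda>\<omega>. v (Suc t) (Xn (Suc t) z \<omega>)) \<in> L" if "z \<in> X1 \<times> X2" for z
        using value_functions t that unfolding value_functions_def by blast+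
      have Qt: "sets (Q t z) = sets (?S1 \<Otimes>\<^sub>M ?S2)" "prob_space (Q t z)"
        if "z \<in> space (state_space X1 X2)" for z
        using measurable_space[OF kernel[OF t] that] by (simp_all add: space_prob_algebra S)
      \<comment> \<open>By the induction hypothesis, moving up in the first component does not
        increase \<open>v (Suc t)\<close>, so its sublevel sets satisfy the upward closure required
        for \<open>B\<close>.\<close>
      have dom: "emeasure (Q t (x1, x2)) {z \<in> space (state_space X1 X2). v (Suc t) z \<le> a}
          \<le> emeasure (Q t (x1', x2)) {z \<in> space (state_space X1 X2). v (Suc t) z \<le> a}" for a
      proof (rule cond_sd_le_emeasure_mono[OF first_component[OF t x le]
            Qt(1)[OF mem'(1)] Qt(1)[OF mem'(2)] Qt(2)[OF mem'(1)] Qt(2)[OF mem'(2)]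
            second_component[OF t x]])
        show "{z \<in> space (state_space X1 X2). v (Suc t) z \<le> a} \<in> sets (?S1 \<Otimes>\<^sub>M ?S2)"
          using borel_measurable_le[OF g borel_measurable_const] unfolding S .
      next
        fix y y' w
        assume y: "y \<in> space ?S1" "y' \<in> space ?S1" "le1 y y'"
          and w: "(y, w) \<in> {z \<in> space (state_space X1 X2). v (Suc t) z \<le> a}"
        have "v (Suc t) (y', w) \<le> v (Suc t) (y, w)"
          using step.IH y w
          by (auto simp: decreasing_in_first_def monotone_on_def S space_pair_measure space_restrict_space)
        then show "(y', w) \<in> {z \<in> space (state_space X1 X2). v (Suc t) z \<le> a}"
          using y w by (auto simp: S space_pair_measure)
      qed
      have costs: "s t (x1', x2) \<le> s t (x1, x2)" "c t (x1', x2) \<le> c t (x1, x2)"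
        using s_decreasing[of t] c_decreasing[of t] t x le
        by (auto simp: decreasing_in_first_def monotone_on_def)
      \<comment> \<open>The recursion holds only almost surely, for each fixed state. Both sides of
        the inequality are constant in \<open>\<omega>\<close>, and on a probability space a
        constant statement true almost everywhere is true.\<close>
      have "AE \<omega> in M. v t (x1', x2) \<le> v t (x1, x2)"
        using risk_mono[OF t invariant[OF t] mem g L[OF mem(1)] L[OF mem(2)] dom]
          dp[OF mem(1)] dp[OF mem(2)]
        by eventually_elim (use costs in linarith)
      then show ?thesis by simp
    qed
    then show ?case by (auto simp: decreasing_in_first_def monotone_on_def)
  qed
qed

end
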